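(* Let $G$ and $F$ be graphs with no loops, no parallel edges and no isolated vertices such that $E(G)=E(F)$, $M_t(G)=M_t(F)$, and $M(G)\neq M(F)$. Suppose that $G$ is not connected. Then $G$ has exactly two components, one of which is a one-edge component and the other of which is a cycle.
   Context: Graphs are finite with non-empty edge set; each edge has two distinct end-vertices. The cycle matroid $M(G)$ is the matroid on $E(G)$ whose bases are the edge sets of maximal forests of $G$. The truncation $M_t$ of a matroid $M$ with set of bases $\mathcal{B}(M)$ is the matroid on the same ground set with set of bases $\{B\setminus\{x\}: B\in\mathcal{B}(M),\ x\in B\}$; put $M_t(G)=(M(G))_t$. Equality of matroids is equality on the labelled ground set. The graph $F$ may or may not be connected. *)

theory Defs
  imports Main
begin

record ('v, 'e) mgraph =
  verts :: "'v set"
  edges :: "'e set"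
  ends :: "'e \<Rightarrow> 'v set"

(* card 2: the two end-vertices of an edge are distinct, so there are no loops. *)
definition graph :: "('v, 'e) mgraph \<Rightarrow> bool" where
  "graph G \<longleftrightarrow> finite (verts G) \<and> finite (edges G) \<and> edges G \<noteq> {} \<and>
     (\<forall>e\<in>edges G. ends G e \<subseteq> verts G \<and> card (ends G e) = 2)"

definition no_parallel_edges :: "('v, 'e) mgraph \<Rightarrow> bool" where
  "no_parallel_edges G \<longleftrightarrow> inj_on (ends G) (edges G)"

definition no_isolated_vertices :: "('v, 'e) mgraph \<Rightarrow> bool" where
  "no_isolated_vertices G \<longleftrightarrow> (\<forall>v\<in>verts G. \<exists>e\<in>edges G. v \<in> ends G e)"

(* A subgraph carries the incidence function of the whole graph unrestricted,
   so subgraphs of a fixed graph are equal iff their vertices and edges agree. *)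
definition subgraph :: "('v, 'e) mgraph \<Rightarrow> ('v, 'e) mgraph \<Rightarrow> bool" where
  "subgraph H G \<longleftrightarrow> verts H \<subseteq> verts G \<and> edges H \<subseteq> edges G \<and> ends H = ends G \<and>
     (\<forall>e\<in>edges H. ends H e \<subseteq> verts H)"

definition maximal_subgraph ::
  "(('v, 'e) mgraph \<Rightarrow> bool) \<Rightarrow> ('v, 'e) mgraph \<Rightarrow> ('v, 'e) mgraph \<Rightarrow> bool" where
  "maximal_subgraph P G H \<longleftrightarrow> subgraph H G \<and> P H \<and>
     (\<forall>K. subgraph K G \<and> P K \<and> subgraph H K \<longrightarrow> K = H)"

definition adjacency :: "('v, 'e) mgraph \<Rightarrow> ('v \<times> 'v) set" where
  "adjacency G = {(u, v). \<exists>e\<in>edges G. ends G e = {u, v}}"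

definition connected_graph :: "('v, 'e) mgraph \<Rightarrow> bool" where
  "connected_graph G \<longleftrightarrow> verts G \<noteq> {} \<and>
     (\<forall>u\<in>verts G. \<forall>v\<in>verts G. (u, v) \<in> (adjacency G)\<^sup>*)"

definition components :: "('v, 'e) mgraph \<Rightarrow> ('v, 'e) mgraph set" where
  "components G = {H. maximal_subgraph connected_graph G H}"

(* The whole graph is a cycle: edge number i joins vertices i and i + 1, cyclically.
   Length 1 would be a loop and length 2 a pair of parallel edges. *)
definition cycle_graph :: "('v, 'e) mgraph \<Rightarrow> bool" where
  "cycle_graph C \<longleftrightarrow> (\<exists>vs es. es \<noteq> [] \<and> length vs = length es \<and> distinct vs \<and> distinct es \<and>
     verts C = set vs \<and> edges C = set es \<and>
     (\<forall>i<length es. ends C (es ! i) = {vs ! i, vs ! (Suc i mod length es)}))"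

definition forest :: "('v, 'e) mgraph \<Rightarrow> bool" where
  "forest H \<longleftrightarrow> (\<nexists>C. subgraph C H \<and> cycle_graph C)"

(* Only the data of a matroid, namely its ground set and its set of bases, so that
   equality of values is equality of matroids on a labelled ground set. *)
record 'e matroid =
  ground :: "'e set"
  bases :: "'e set set"

definition cycle_matroid :: "('v, 'e) mgraph \<Rightarrow> 'e matroid" where
  "cycle_matroid G =
     \<lparr>ground = edges G, bases = {edges H | H. maximal_subgraph forest G H}\<rparr>"

definition truncation :: "'e matroid \<Rightarrow> 'e matroid" where
  "truncation M =
     \<lparr>ground = ground M, bases = {B - {x} | B x. B \<in> bases M \<and> x \<in> B}\<rparr>"

end

theory Submission
  imports Defs
begin

text \<open>Write $r$ for the common rank. The truncation determines the independent sets of size less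
  than $r$, and hence which edge sets of size less than $r$ lie in the cycle space (an edge set lies
  in it when all degrees are even). So if the matroids differ, some $C$ of size $r$ is a
  circuit of one graph and a basis of the other.

  If $C$ is a circuit of $G$, then, as $G$ is disconnected, it spans all of $G$ except for one
  isolated edge. A chord would split $C$ into two cycles shorter than $r$, which would also be
  cycles of $F$ with sum $C$. If $C$ is a basis of $G$, then no fundamental circuit of $G$ with
  respect to $C$ is shorter than $r$: adding it to the cycle $C$ of $F$ gives another short cycle
  of $F$, hence of $G$, and the sum of the two would put $C$ into the cycle space of $G$. As $G$
  is disconnected, every fundamental circuit thus misses exactly one edge of $C$, always the
  isolated one, so two distinct non-basis edges would be parallel.\<close>

section \<open>Binary matroids\<close>

locale binary_matroid =
  fixes E :: "'e set" and Z :: "'e set set"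
  assumes finite_ground: "finite E"
    and Z_subset: "X \<in> Z \<Longrightarrow> X \<subseteq> E"
    and empty_in_Z: "{} \<in> Z"
    and sym_diff_in_Z: "X \<in> Z \<Longrightarrow> Y \<in> Z \<Longrightarrow> sym_diff X Y \<in> Z"
begin

definition indep :: "'e set \<Rightarrow> bool" where
  "indep A \<longleftrightarrow> A \<subseteq> E \<and> (\<forall>X\<in>Z. X \<subseteq> A \<longrightarrow> X = {})"

definition basis :: "'e set \<Rightarrow> bool" where
  "basis B \<longleftrightarrow> indep B \<and> (\<forall>f\<in>E - B. \<not> indep (insert f B))"

definition circuit :: "'e set \<Rightarrow> bool" where
  "circuit C \<longleftrightarrow> C \<in> Z \<and> C \<noteq> {} \<and> (\<forall>X\<in>Z. X \<subset> C \<longrightarrow> X = {})"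

lemma indep_subset: "indep A \<Longrightarrow> B \<subseteq> A \<Longrightarrow> indep B"
  unfolding indep_def by blast

lemma indep_finite: "indep A \<Longrightarrow> finite A"
  unfolding indep_def using finite_ground finite_subset by blast

lemma Z_finite: "X \<in> Z \<Longrightarrow> finite X"
  using Z_subset finite_ground finite_subset by blast

lemma exists_spanned_by:
  assumes I: "indep I" and sp: "\<And>j. j \<in> J \<Longrightarrow> j \<in> I \<or> \<not> indep (insert j I)"
    and J: "J \<subseteq> E" and S: "S \<subseteq> J"
  shows "\<exists>T\<subseteq>I. sym_diff S T \<in> Z"
proof -
  have "finite S" using S J finite_ground by (meson finite_subset)
  then show ?thesis using S
  proof (induction S rule: finite_induct)
    case empty
    then show ?case using empty_in_Z by (intro exI[of _ "{}"]) auto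
  next
    case (insert j S)
    then obtain T where T: "T \<subseteq> I" "sym_diff S T \<in> Z" by auto
    show ?case
    proof (cases "j \<in> I")
      case True
      have "sym_diff (insert j S) (sym_diff T {j}) = sym_diff S T"
        using insert.hyps by auto
      then show ?thesis using T True by (intro exI[of _ "sym_diff T {j}"]) auto
    next
      case False
      with sp insert.prems have "\<not> indep (insert j I)" by blast
      moreover have "insert j I \<subseteq> E" using I J insert.prems indep_def by auto
      ultimately obtain X where X: "X \<in> Z" "X \<subseteq> insert j I" "X \<noteq> {}"
        unfolding indep_def by blast
      then have jX: "j \<in> X" using I unfolding indep_def by blast
      have "sym_diff (insert j S) (sym_diff T (X - {j})) = sym_diff (sym_diff S T) X"
        using insert.hyps jX False T(1) by auto
      then show ?thesis using sym_diff_in_Z[OF T(2) X(1)] T X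
        by (intro exI[of _ "sym_diff T (X - {j})"]) auto
    qed
  qed
qed

lemma augment:
  assumes I: "indep I" and J: "indep J" and less: "card I < card J"
  obtains j where "j \<in> J" "j \<notin> I" "indep (insert j I)"
proof -
  have "\<exists>j\<in>J. j \<notin> I \<and> indep (insert j I)"
  proof (rule ccontr)
    assume no: "\<not> ?thesis"
    have JE: "J \<subseteq> E" using J indep_def by auto
    have "\<forall>S\<in>Pow J. \<exists>T. T \<subseteq> I \<and> sym_diff S T \<in> Z"
      using exists_spanned_by[OF I _ JE] no by blast
    then obtain t where t: "\<And>S. S \<in> Pow J \<Longrightarrow> t S \<subseteq> I \<and> sym_diff S (t S) \<in> Z" by metis
    have "inj_on t (Pow J)"
    proof (rule inj_onI)
      fix S S' assume S: "S \<in> Pow J" "S' \<in> Pow J" and eq: "t S = t S'"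
      have "sym_diff (sym_diff S (t S)) (sym_diff S' (t S')) = sym_diff S S'"
        using eq by auto
      then have "sym_diff S S' \<in> Z" using t[OF S(1)] t[OF S(2)] sym_diff_in_Z by metis
      moreover have "sym_diff S S' \<subseteq> J" using S by auto
      ultimately have "sym_diff S S' = {}" using J unfolding indep_def by blast
      then show "S = S'" by auto
    qed
    moreover have "t ` Pow J \<subseteq> Pow I" using t by auto
    ultimately have "card (Pow J) \<le> card (Pow I)"
      using indep_finite[OF I] by (meson card_inj_on_le finite_Pow_iff)
    then show False using less indep_finite[OF I] indep_finite[OF J]
      by (simp add: card_Pow)
  qed
  then show thesis using that by blast
qed

lemma indep_card_le_basis:
  assumes "indep I" and "basis B"
  shows "card I \<le> card B"
proof (rule ccontr)
  assume "\<not> ?thesis"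
  then obtain j where j: "j \<in> I" "j \<notin> B" "indep (insert j B)"
    using augment[of B I] assms unfolding basis_def by auto
  then show False using assms unfolding basis_def indep_def by blast
qed

lemma basis_card_eq: "basis B \<Longrightarrow> basis B' \<Longrightarrow> card B = card B'"
  using indep_card_le_basis unfolding basis_def by (meson le_antisym)

lemma extend_to_basis:
  assumes "indep I"
  obtains B where "I \<subseteq> B" "basis B"
proof -
  let ?S = "{B. indep B \<and> I \<subseteq> B}"
  have "finite ?S" by (rule finite_subset[of _ "Pow E"]) (auto simp: indep_def finite_ground)
  moreover have "I \<in> ?S" using assms by auto
  ultimately obtain B where BS: "B \<in> ?S" and max: "\<forall>A\<in>?S. B \<subseteq> A \<longrightarrow> B = A"
    using finite_has_maximal2[of ?S I] by meson
  have "basis B" unfolding basis_def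
  proof (intro conjI ballI notI)
    show "indep B" using BS by auto
    fix f assume f: "f \<in> E - B" "indep (insert f B)"
    then have "insert f B \<in> ?S" using BS by auto
    with max f(1) show False by blast
  qed
  then show thesis using that BS by auto
qed

lemma indep_card_basis:
  assumes "indep I" and "basis B" and "card I = card B"
  shows "basis I"
  unfolding basis_def
proof (intro conjI ballI notI)
  show "indep I" by fact
  fix f assume f: "f \<in> E - I" "indep (insert f I)"
  then have "card (insert f I) = Suc (card I)" using indep_finite[OF assms(1)] by simp
  then show False using indep_card_le_basis[OF f(2) assms(2)] assms(3) by simp
qed

lemma basis_fundamental:
  assumes "basis B" and "f \<in> E" and "f \<notin> B"
  obtains X where "circuit X" "f \<in> X" "X \<subseteq> insert f B"
proof -
  have "\<not> indep (insert f B)" "indep B" using assms unfolding basis_def by auto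
  then obtain X where X: "X \<in> Z" "X \<subseteq> insert f B" "X \<noteq> {}"
    using assms(2) unfolding indep_def by blast
  have fin: "f \<in> Y" if "Y \<in> Z" "Y \<subseteq> insert f B" "Y \<noteq> {}" for Y
    using \<open>indep B\<close> that unfolding indep_def by blast
  have "circuit X" unfolding circuit_def
  proof (intro conjI ballI impI)
    fix Y assume Y: "Y \<in> Z" "Y \<subset> X"
    show "Y = {}"
    proof (rule ccontr)
      assume "Y \<noteq> {}"
      then have "f \<in> Y" "f \<in> X" using fin X Y by auto
      then have "f \<notin> sym_diff X Y" by auto
      moreover have "sym_diff X Y \<in> Z" "sym_diff X Y \<subseteq> insert f B" "sym_diff X Y \<noteq> {}"
        using sym_diff_in_Z X Y by auto
      ultimately show False using fin by blast
    qed
  qed (use X in auto)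
  then show thesis using that X fin by blast
qed

lemma dependent_contains_circuit:
  assumes "X \<in> Z" and "X \<noteq> {}"
  obtains C where "circuit C" "C \<subseteq> X"
proof -
  let ?S = "{Y \<in> Z. Y \<subseteq> X \<and> Y \<noteq> {}}"
  have "finite ?S"
    by (rule finite_subset[of _ "Pow X"]) (auto simp: Z_finite[OF assms(1)])
  moreover have "X \<in> ?S" using assms by auto
  ultimately obtain C where CS: "C \<in> ?S" and min: "\<forall>A\<in>?S. A \<subseteq> C \<longrightarrow> C = A"
    using finite_has_minimal2[of ?S X] by meson
  have "circuit C" unfolding circuit_def
  proof (intro conjI ballI impI)
    fix Y assume Y: "Y \<in> Z" "Y \<subset> C"
    show "Y = {}"
    proof (rule ccontr)
      assume "Y \<noteq> {}"
      then have "Y \<in> ?S" using Y CS by auto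
      with min Y(2) show False by blast
    qed
  qed (use CS in auto)
  then show thesis using that CS by auto
qed

lemma circuit_minimal: "circuit C \<Longrightarrow> X \<in> Z \<Longrightarrow> X \<noteq> {} \<Longrightarrow> X \<subseteq> C \<Longrightarrow> X = C"
  unfolding circuit_def by blast

lemma circuit_minus_indep: "circuit C \<Longrightarrow> e \<in> C \<Longrightarrow> indep (C - {e})"
  unfolding circuit_def indep_def using Z_subset by blast

end

locale same_truncation = M: binary_matroid E Z + N: binary_matroid E Z'
  for E :: "'e set" and Z Z' +
  assumes truncations: "{B - {x} | B x. M.basis B \<and> x \<in> B} = {B - {x} | B x. N.basis B \<and> x \<in> B}"
    and nonempty_basis: "M.basis B \<Longrightarrow> B \<noteq> {}" "N.basis B' \<Longrightarrow> B' \<noteq> {}"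
begin

lemma same_truncation_sym: "same_truncation E Z' Z"
  using truncations nonempty_basis by unfold_locales auto

lemma truncation_transfer:
  assumes "M.basis B" and "x \<in> B"
  obtains B' x' where "N.basis B'" "x' \<in> B'" "B - {x} = B' - {x'}"
proof -
  have "B - {x} \<in> {B - {x} | B x. N.basis B \<and> x \<in> B}"
    unfolding truncations[symmetric] using assms by blast
  then show thesis using that by blast
qed

lemma rank_eq:
  assumes "M.basis B" and "N.basis B'"
  shows "card B = card B'"
proof -
  obtain x where x: "x \<in> B" using nonempty_basis assms by blast
  obtain B2 x2 where B2: "N.basis B2" "x2 \<in> B2" "B - {x} = B2 - {x2}"
    using truncation_transfer[OF assms(1) x] .
  have "finite B" "finite B2"
    using assms B2 M.indep_finite N.indep_finite unfolding M.basis_def N.basis_def by auto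
  then have "card B = card B2" using B2 x by (metis card_Suc_Diff1)
  then show ?thesis using N.basis_card_eq[OF B2(1) assms(2)] by simp
qed

lemma indep_transfer:
  assumes A: "M.indep A" and B: "M.basis B" and less: "card A < card B"
  shows "N.indep A"
proof -
  obtain C where C: "A \<subseteq> C" "M.basis C" using M.extend_to_basis[OF A] .
  then have "card C = card B" using B M.basis_card_eq by blast
  then obtain x where x: "x \<in> C" "x \<notin> A" using less C by (metis nat_neq_iff subsetI subset_antisym)
  obtain B2 x2 where B2: "N.basis B2" "x2 \<in> B2" "C - {x} = B2 - {x2}"
    using truncation_transfer[OF C(2) x(1)] .
  then have "A \<subseteq> B2" using C x by blast
  then show ?thesis using B2 N.indep_subset unfolding N.basis_def by blast
qed

end

context same_truncation
begin

lemma Z_transfer: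
  assumes "X \<in> Z" and B: "M.basis B" and "card X < card B"
  shows "X \<in> Z'"
  using assms(1,3)
proof (induction "card X" arbitrary: X rule: less_induct)
  case less
  interpret S: same_truncation E Z' Z by (rule same_truncation_sym)
  show ?case
  proof (cases "X = {}")
    case True
    then show ?thesis using N.empty_in_Z by simp
  next
    case False
    then obtain C where C: "M.circuit C" "C \<subseteq> X"
      using M.dependent_contains_circuit less.prems by blast
    have finX: "finite X" using M.Z_finite less.prems by auto
    obtain B' where B': "N.basis B'" 
      using N.extend_to_basis[of "{}"] N.indep_def by auto
    have rk: "card B = card B'" using rank_eq B B' .
    have cC: "card C < card B" using C less.prems finX by (meson card_mono le_less_trans)
    have CE: "C \<in> Z" "C \<noteq> {}" "C \<subseteq> E" using C M.Z_subset unfolding M.circuit_def by auto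
    have "\<not> N.indep C"
      using S.indep_transfer[of C B'] B' rk cC CE unfolding M.indep_def by auto
    then obtain Y where Y: "Y \<in> Z'" "Y \<subseteq> C" "Y \<noteq> {}"
      using CE unfolding N.indep_def by blast
    have "Y = C"
    proof (rule ccontr)
      assume "Y \<noteq> C"
      then obtain e where e: "e \<in> C" "e \<notin> Y" using Y by auto
      have "M.indep (C - {e})" using M.circuit_minus_indep C e by auto
      moreover have "card (C - {e}) < card B"
        using cC by (meson card_Diff1_le C(2) finX finite_subset le_less_trans)
      ultimately have "N.indep (C - {e})" using indep_transfer B by blast
      then show False using Y e unfolding N.indep_def by blast
    qed
    then have CZ': "C \<in> Z'" using Y by simp
    have "sym_diff X C = X - C" using C by auto
    then have "X - C \<in> Z" using M.sym_diff_in_Z[OF less.prems(1) CE(1)] by simp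
    moreover have "card (X - C) < card X"
      using C CE finX by (intro psubset_card_mono) auto
    ultimately have "X - C \<in> Z'" using less by simp
    moreover have "sym_diff (X - C) C = X" using C by auto
    ultimately show ?thesis using N.sym_diff_in_Z[OF _ CZ'] by metis
  qed
qed

lemma basis_to_circuit:
  assumes B: "M.basis B" and "\<not> N.basis B"
  shows "N.circuit B"
proof -
  obtain B' where B': "N.basis B'"
    using N.extend_to_basis[of "{}"] N.indep_def by auto
  have iB: "M.indep B" using B M.basis_def by auto
  have "\<not> N.indep B"
    using N.indep_card_basis[OF _ B'] rank_eq[OF B B'] assms(2) by auto
  moreover have BE: "B \<subseteq> E" using iB unfolding M.indep_def by auto
  ultimately obtain Y where Y: "Y \<in> Z'" "Y \<subseteq> B" "Y \<noteq> {}"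
    unfolding N.indep_def by blast
  have minus: "N.indep (B - {e})" if "e \<in> B" for e
  proof (rule indep_transfer[OF _ B])
    show "M.indep (B - {e})" using M.indep_subset[OF iB] by blast
    show "card (B - {e}) < card B" using M.indep_finite[OF iB] that by (rule card_Diff1_less)
  qed
  have all: "X = {} \<or> X = B" if "X \<in> Z'" "X \<subseteq> B" for X
  proof (rule ccontr)
    assume X: "\<not> ?thesis"
    then obtain e where e: "e \<in> B" "e \<notin> X" using \<open>X \<subseteq> B\<close> by blast
    then show False using minus[OF e(1)] that X unfolding N.indep_def by blast
  qed
  then show ?thesis using Y unfolding N.circuit_def by blast
qed

end

section \<open>The cycle space of a graph\<close>

definition cycle_space :: "('v, 'e) mgraph \<Rightarrow> 'e set set" where
  "cycle_space G = {X. X \<subseteq> edges G \<and> (\<forall>v. even (card {e \<in> X. v \<in> ends G e}))}"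

definition edge_subgraph :: "('v, 'e) mgraph \<Rightarrow> 'e set \<Rightarrow> ('v, 'e) mgraph" where
  "edge_subgraph G X = \<lparr>verts = \<Union>(ends G ` X), edges = X, ends = ends G\<rparr>"

lemma edge_subgraph_simps [simp]:
  "verts (edge_subgraph G X) = \<Union>(ends G ` X)"
  "edges (edge_subgraph G X) = X"
  "ends (edge_subgraph G X) = ends G"
  by (simp_all add: edge_subgraph_def)

lemma even_card_sym_diff:
  assumes "finite A" and "finite B"
  shows "even (card (sym_diff A B)) \<longleftrightarrow> (even (card A) \<longleftrightarrow> even (card B))"
proof -
  have "card (sym_diff A B) = card (A - B) + card (B - A)"
    using assms by (intro card_Un_disjoint) auto
  moreover have "card A = card (A - B) + card (A \<inter> B)"
    using assms by (subst card_Un_disjoint[symmetric]) (auto intro: arg_cong[of _ _ card])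
  moreover have "card B = card (B - A) + card (A \<inter> B)"
    using assms by (subst card_Un_disjoint[symmetric]) (auto intro: arg_cong[of _ _ card])
  ultimately show ?thesis by presburger
qed

lemma binary_matroid_cycle_space:
  assumes "finite (edges G)"
  shows "binary_matroid (edges G) (cycle_space G)"
proof
  show "finite (edges G)" by fact
  show "X \<subseteq> edges G" if "X \<in> cycle_space G" for X
    using that by (simp add: cycle_space_def)
  show "{} \<in> cycle_space G" by (simp add: cycle_space_def)
  show "sym_diff X Y \<in> cycle_space G" if XY: "X \<in> cycle_space G" "Y \<in> cycle_space G" for X Y
  proof -
    have sub: "X \<subseteq> edges G" "Y \<subseteq> edges G" using XY by (auto simp: cycle_space_def)
    then have fin: "finite X" "finite Y" using assms finite_subset by auto
    have "even (card {e \<in> sym_diff X Y. v \<in> ends G e})" for v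
    proof -
      have "{e \<in> sym_diff X Y. v \<in> ends G e}
          = sym_diff {e \<in> X. v \<in> ends G e} {e \<in> Y. v \<in> ends G e}" by auto
      then show ?thesis using XY fin by (simp add: even_card_sym_diff cycle_space_def)
    qed
    then show ?thesis using sub unfolding cycle_space_def by auto
  qed
qed

lemma cycle_graph_degree_even:
  assumes "cycle_graph C" and two: "\<forall>e\<in>edges C. card (ends C e) = 2"
  shows "even (card {e \<in> edges C. v \<in> ends C e})"
proof -
  obtain vs es where c: "es \<noteq> []" "length vs = length es" "distinct vs" "distinct es"
    "edges C = set es"
    and en: "\<And>i. i < length es \<Longrightarrow> ends C (es ! i) = {vs ! i, vs ! (Suc i mod length es)}"
    using assms(1) unfolding cycle_graph_def by blast
  define n where "n = length es"
  have n0: "n > 0" using c n_def by simp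
  have "n \<noteq> 1"
  proof
    assume "n = 1"
    then have "ends C (es ! 0) = {vs ! 0}" using en[of 0] n_def by simp
    moreover have "es ! 0 \<in> edges C" using c by simp
    ultimately show False using two by fastforce
  qed
  with n0 have n2: "n \<ge> 2" by simp
  show ?thesis
  proof (cases "v \<in> set vs")
    case False
    have "v \<notin> ends C e" if e: "e \<in> set es" for e
    proof -
      obtain i where i: "i < n" "e = es ! i" using e n_def by (metis in_set_conv_nth)
      have "Suc i mod n < n" using n0 by simp
      then show ?thesis using False en[of i] i c n_def by (metis insert_iff nth_mem singletonD)
    qed
    then have "{e \<in> edges C. v \<in> ends C e} = {}" using c by auto
    then show ?thesis by (metis card.empty even_zero)
  next
    case True
    then obtain k where k: "k < n" "v = vs ! k" using c n_def by (metis in_set_conv_nth)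
    define p where "p = (if k = 0 then n - 1 else k - 1)"
    have p: "p < n" "p \<noteq> k" using k n2 p_def by auto
    have mem: "v \<in> ends C (es ! i) \<longleftrightarrow> i = k \<or> i = p" if i: "i < n" for i
    proof -
      have "Suc i mod n < n" using n0 by simp
      then have "v \<in> ends C (es ! i) \<longleftrightarrow> i = k \<or> Suc i mod n = k"
        using en[of i] i k c n_def nth_eq_iff_index_eq[of vs] by auto
      moreover have "Suc i mod n = k \<longleftrightarrow> i = p"
        using i k n2 unfolding p_def by (cases "Suc i = n") auto
      ultimately show ?thesis by simp
    qed
    have "{e \<in> edges C. v \<in> ends C e} = {es ! k, es ! p}"
    proof
      show "{e \<in> edges C. v \<in> ends C e} \<subseteq> {es ! k, es ! p}"
      proof
        fix e assume e: "e \<in> {e \<in> edges C. v \<in> ends C e}"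
        then obtain i where "i < n" "e = es ! i" using c n_def by (auto simp: in_set_conv_nth)
        then show "e \<in> {es ! k, es ! p}" using mem e by auto
      qed
      show "{es ! k, es ! p} \<subseteq> {e \<in> edges C. v \<in> ends C e}"
        using mem k p c n_def by auto
    qed
    moreover have "es ! k \<noteq> es ! p"
      using p k c n_def by (simp add: nth_eq_iff_index_eq)
    ultimately show ?thesis by simp
  qed
qed

text \<open>A longest path closes up to a cycle at its first vertex.\<close>

lemma min_degree_two_contains_cycle:
  assumes fin: "finite X" and "X \<noteq> {}" and two: "\<And>e. e \<in> X \<Longrightarrow> card (ends G e) = 2"
    and other: "\<And>e v. e \<in> X \<Longrightarrow> v \<in> ends G e \<Longrightarrow> \<exists>f\<in>X. f \<noteq> e \<and> v \<in> ends G f"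
  obtains D where "D \<subseteq> X" "D \<noteq> {}" "cycle_graph (edge_subgraph G D)"
proof -
  define path where "path = (\<lambda>(vs, es). es \<noteq> [] \<and> distinct vs \<and> length vs = Suc (length es) \<and>
    (\<forall>i<length es. es ! i \<in> X \<and> ends G (es ! i) = {vs ! i, vs ! Suc i}))"
  let ?V = "\<Union>(ends G ` X)"
  have finV: "finite ?V" using fin two by (metis card.infinite finite_UN_I zero_neq_numeral)
  have bound: "length (snd q) \<le> card ?V" if "path q" for q
  proof -
    obtain vs es where q: "q = (vs, es)" by (cases q)
    have pa: "es \<noteq> []" "distinct vs" "length vs = Suc (length es)"
      "\<And>i. i < length es \<Longrightarrow> es ! i \<in> X \<and> ends G (es ! i) = {vs ! i, vs ! Suc i}"
      using that unfolding path_def q by auto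
    have "set vs \<subseteq> ?V"
    proof
      fix v assume "v \<in> set vs"
      then obtain i where i: "i < length vs" "v = vs ! i" by (metis in_set_conv_nth)
      show "v \<in> ?V"
      proof (cases "i < length es")
        case True
        then show ?thesis using pa(4)[of i] i by auto
      next
        case False
        then have "i = Suc (length es - 1)" "length es - 1 < length es" using i pa by auto
        then show ?thesis using pa(4)[of "length es - 1"] i by (metis UN_I insert_iff)
      qed
    qed
    then have "length vs \<le> card ?V" using pa(2) finV by (metis card_mono distinct_card)
    then show ?thesis using pa(3) q by simp
  qed
  obtain e where e: "e \<in> X" using assms by auto
  obtain u v where uv: "ends G e = {u, v}" "u \<noteq> v" using two[OF e] by (metis card_2_iff)
  have "path ([u, v], [e])" unfolding path_def using e uv by auto
  then have "\<exists>q. path q \<and> (\<forall>q'. path q' \<longrightarrow> length (snd q') \<le> length (snd q))"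
    using bound by (intro ex_has_greatest_nat[of path _ "\<lambda>q. length (snd q)" "Suc (card ?V)"])
      (auto simp: le_imp_less_Suc)
  then obtain vs es where p: "path (vs, es)"
    and max: "\<And>vs' es'. path (vs', es') \<Longrightarrow> length es' \<le> length es"
    by auto
  have pa: "es \<noteq> []" "distinct vs" "length vs = Suc (length es)"
    "\<And>i. i < length es \<Longrightarrow> es ! i \<in> X \<and> ends G (es ! i) = {vs ! i, vs ! Suc i}"
    using p unfolding path_def by auto
  have e0: "es ! 0 \<in> X" "vs ! 0 \<in> ends G (es ! 0)" using pa(4)[of 0] pa(1) by auto
  obtain f where f: "f \<in> X" "f \<noteq> es ! 0" "vs ! 0 \<in> ends G f" using other[OF e0] by blast
  obtain a b where "ends G f = {a, b}" "a \<noteq> b" using two[OF f(1)] unfolding card_2_iff by blast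
  then obtain w where w: "ends G f = {vs ! 0, w}" "w \<noteq> vs ! 0"
    using that f(3) by (cases "vs ! 0 = a") (auto simp: insert_commute)
  have "w \<in> set vs"
  proof (rule ccontr)
    assume "w \<notin> set vs"
    have "(f # es) ! i \<in> X \<and> ends G ((f # es) ! i) = {(w # vs) ! i, (w # vs) ! Suc i}"
      if "i < length (f # es)" for i
      using that pa(4) f w by (cases i) auto
    then have "path (w # vs, f # es)" unfolding path_def using pa \<open>w \<notin> set vs\<close> by auto
    then show False using max by fastforce
  qed
  then obtain j where j: "j < length vs" "w = vs ! j" by (metis in_set_conv_nth)
  have j0: "j > 0" "j \<le> length es" using j w(2) pa(3) by (auto intro: gr0I)
  define us where "us = take (Suc j) vs"
  define fs where "fs = take j es @ [f]"
  have len: "length us = Suc j" "length fs = Suc j" using us_def fs_def j0 j by auto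
  have fs_nth: "fs ! i = es ! i" if "i < j" for i using that fs_def j0 by (simp add: nth_append)
  have fs_j: "fs ! j = f" using fs_def j0 by (simp add: nth_append)
  have us_nth: "us ! i = vs ! i" if "i \<le> j" for i using that us_def by simp
  have ends_fs: "ends G (fs ! i) = {us ! i, us ! (Suc i mod Suc j)}" if "i < Suc j" for i
  proof (cases "i = j")
    case True
    then show ?thesis using fs_j w j us_nth[of j] us_nth[of 0] by auto
  next
    case False
    then have "i < j" using that by simp
    then show ?thesis using fs_nth[of i] pa(4)[of i] j0 us_nth[of i] us_nth[of "Suc i"] by auto
  qed
  have inX: "fs ! i \<in> X" if "i < Suc j" for i
    using that fs_nth[of i] fs_j pa(4)[of i] f(1) j0 by (cases "i = j") auto
  have dus: "distinct us" using us_def pa(2) by simp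
  have nthv: "vs ! a = vs ! b \<longleftrightarrow> a = b" if "a \<le> length es" "b \<le> length es" for a b
    using that pa(2,3) by (simp add: nth_eq_iff_index_eq)
  have inj: "es ! a \<noteq> es ! b" if "a < b" "b < length es" for a b
  proof
    assume "es ! a = es ! b"
    then have "vs ! a \<in> {vs ! b, vs ! Suc b}" using pa(4)[of a] pa(4)[of b] that by auto
    then show False using nthv[of a b] nthv[of a "Suc b"] that by auto
  qed
  have "distinct es" unfolding distinct_conv_nth
    using inj by (metis linorder_neqE_nat)
  moreover have "f \<notin> set (take j es)"
  proof
    assume "f \<in> set (take j es)"
    then obtain i where i: "i < j" "f = es ! i" using j0 by (auto simp: in_set_conv_nth)
    then have "vs ! 0 \<in> {vs ! i, vs ! Suc i}" using f(3) pa(4)[of i] j0 by auto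
    then have "i = 0" using nthv[of 0 i] nthv[of 0 "Suc i"] i j0 by auto
    then show False using f(2) i by simp
  qed
  ultimately have dfs: "distinct fs" using fs_def by simp
  let ?D = "set fs"
  have "\<Union>(ends G ` ?D) = set us"
  proof
    show "\<Union>(ends G ` ?D) \<subseteq> set us"
    proof
      fix x assume "x \<in> \<Union>(ends G ` ?D)"
      then obtain i where i: "i < Suc j" "x \<in> ends G (fs ! i)"
        using len by (auto simp: in_set_conv_nth)
      have "Suc i mod Suc j < length us" using len by simp
      then show "x \<in> set us" using ends_fs[OF i(1)] i len by (metis insertE nth_mem singletonD)
    qed
    show "set us \<subseteq> \<Union>(ends G ` ?D)"
    proof
      fix x assume "x \<in> set us"
      then obtain i where i: "i < Suc j" "x = us ! i" using len by (metis in_set_conv_nth)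
      then have "x \<in> ends G (fs ! i)" "fs ! i \<in> ?D" using ends_fs[OF i(1)] len by auto
      then show "x \<in> \<Union>(ends G ` ?D)" by blast
    qed
  qed
  then have "cycle_graph (edge_subgraph G ?D)" unfolding cycle_graph_def
    using dus dfs len ends_fs by (intro exI[of _ us] exI[of _ fs]) auto
  moreover have "?D \<subseteq> X" using inX len by (auto simp: in_set_conv_nth)
  moreover have "?D \<noteq> {}" using fs_def by simp
  ultimately show thesis using that by blast
qed

lemma sym_adjacency: "sym (adjacency H)"
  unfolding sym_def adjacency_def by (auto simp: insert_commute)

lemma adjacency_rtrancl_sym: "(u, v) \<in> (adjacency H)\<^sup>* \<Longrightarrow> (v, u) \<in> (adjacency H)\<^sup>*"
  using sym_rtrancl[OF sym_adjacency] by (rule symD)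

lemma ends_reachable:
  assumes "e \<in> edges H" and "card (ends H e) = 2" and "x \<in> ends H e" and "y \<in> ends H e"
  shows "(x, y) \<in> (adjacency H)\<^sup>*"
proof (cases "x = y")
  case False
  then have "ends H e = {x, y}" using assms by (auto simp: card_2_iff)
  then show ?thesis using assms(1) unfolding adjacency_def by auto
qed simp

lemma connected_graph_hub:
  assumes "w \<in> verts H" and "\<And>v. v \<in> verts H \<Longrightarrow> (v, w) \<in> (adjacency H)\<^sup>*"
  shows "connected_graph H"
  unfolding connected_graph_def
proof (intro conjI ballI)
  show "verts H \<noteq> {}" using assms(1) by blast
  fix u v assume "u \<in> verts H" "v \<in> verts H"
  then show "(u, v) \<in> (adjacency H)\<^sup>*"
    using rtrancl_trans[OF assms(2) adjacency_rtrancl_sym[OF assms(2)]] by simp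
qed

locale simple_graph =
  fixes G :: "('v, 'e) mgraph"
  assumes graph_G: "graph G" and no_parallel: "no_parallel_edges G"
    and no_isolated: "no_isolated_vertices G"
begin

lemma card_ends: "e \<in> edges G \<Longrightarrow> card (ends G e) = 2"
  using graph_G unfolding graph_def by auto

lemma ends_subset: "e \<in> edges G \<Longrightarrow> ends G e \<subseteq> verts G"
  using graph_G unfolding graph_def by auto

lemma ends_nonempty: "e \<in> edges G \<Longrightarrow> ends G e \<noteq> {}"
  using card_ends by fastforce

lemma ends_eqD: "e \<in> edges G \<Longrightarrow> f \<in> edges G \<Longrightarrow> ends G e = ends G f \<Longrightarrow> e = f"
  using no_parallel unfolding no_parallel_edges_def by (auto dest: inj_onD)

sublocale binary_matroid "edges G" "cycle_space G"
  using graph_G unfolding graph_def by (intro binary_matroid_cycle_space) auto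

lemma cycle_space_other_edge:
  assumes X: "X \<in> cycle_space G" and e: "e \<in> X" "v \<in> ends G e"
  obtains f where "f \<in> X" "f \<noteq> e" "v \<in> ends G f"
proof -
  let ?S = "{f \<in> X. v \<in> ends G f}"
  have "even (card ?S)" using X unfolding cycle_space_def by auto
  then have "?S \<noteq> {e}" by force
  then show thesis using that e by blast
qed

lemma cycle_space_card_ge_3:
  assumes X: "X \<in> cycle_space G" and "X \<noteq> {}"
  shows "3 \<le> card X"
proof -
  obtain e where e: "e \<in> X" using assms by auto
  have eE: "\<And>f. f \<in> X \<Longrightarrow> f \<in> edges G" using Z_subset[OF X] by auto
  obtain u v where uv: "ends G e = {u, v}" "u \<noteq> v"
    using card_ends[OF eE[OF e]] by (metis card_2_iff)
  obtain f where f: "f \<in> X" "f \<noteq> e" "u \<in> ends G f"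
    using cycle_space_other_edge[OF X e, of u] uv by auto
  obtain g where g: "g \<in> X" "g \<noteq> e" "v \<in> ends G g"
    using cycle_space_other_edge[OF X e, of v] uv by auto
  have "f \<noteq> g"
  proof
    assume "f = g"
    then have "ends G f = {u, v}" using f g uv card_ends[OF eE[OF f(1)]] by (auto simp: card_2_iff)
    then show False using ends_eqD[OF eE[OF f(1)] eE[OF e]] uv f by simp
  qed
  then have "card {e, f, g} = 3" using f g by auto
  moreover have "card {e, f, g} \<le> card X"
    using e f g Z_finite[OF X] by (intro card_mono) auto
  ultimately show ?thesis by simp
qed

lemma isolated_edge_not_in_cycle_space:
  assumes X: "X \<in> cycle_space G" and h: "h \<in> edges G"
    and iso: "\<And>f. f \<in> edges G \<Longrightarrow> f \<noteq> h \<Longrightarrow> ends G f \<inter> ends G h = {}"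
  shows "h \<notin> X"
proof
  assume "h \<in> X"
  obtain v where "v \<in> ends G h" using ends_nonempty[OF h] by auto
  with \<open>h \<in> X\<close> obtain f where "f \<in> X" "f \<noteq> h" "v \<in> ends G f"
    using cycle_space_other_edge[OF X] by metis
  then show False using iso[of f] \<open>v \<in> ends G h\<close> Z_subset[OF X] by auto
qed

lemma cycle_space_contains_cycle:
  assumes X: "X \<in> cycle_space G" and "X \<noteq> {}"
  obtains D where "D \<subseteq> X" "D \<noteq> {}" "cycle_graph (edge_subgraph G D)"
proof (rule min_degree_two_contains_cycle[of X G])
  show "finite X" "X \<noteq> {}" using Z_finite[OF X] assms by auto
  show "card (ends G e) = 2" if "e \<in> X" for e using that card_ends Z_subset[OF X] by auto
  show "\<exists>f\<in>X. f \<noteq> e \<and> v \<in> ends G f" if "e \<in> X" "v \<in> ends G e" for e v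
    using cycle_space_other_edge[OF X that] by blast
qed (rule that)

lemma cycle_edges_in_cycle_space:
  assumes "cycle_graph C" and "edges C \<subseteq> edges G" and "ends C = ends G"
  shows "edges C \<in> cycle_space G"
  using cycle_graph_degree_even[OF assms(1)] card_ends assms(2,3)
  unfolding cycle_space_def by auto

lemma circuit_cycle_graph:
  assumes "circuit D"
  shows "cycle_graph (edge_subgraph G D)"
proof -
  have D: "D \<in> cycle_space G" "D \<noteq> {}" using assms unfolding circuit_def by auto
  obtain X where X: "X \<subseteq> D" "X \<noteq> {}" "cycle_graph (edge_subgraph G X)"
    using cycle_space_contains_cycle[OF D] .
  have "X \<in> cycle_space G"
    using cycle_edges_in_cycle_space[OF X(3)] X(1) Z_subset[OF D(1)] by auto
  then have "X = D" using circuit_minimal assms X by blast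
  then show ?thesis using X by simp
qed

lemma forest_iff_indep:
  assumes H: "subgraph H G"
  shows "forest H \<longleftrightarrow> indep (edges H)"
proof
  have en: "ends H = ends G" "edges H \<subseteq> edges G" using H unfolding subgraph_def by auto
  show "indep (edges H)" if fo: "forest H"
  proof (rule ccontr)
    assume "\<not> indep (edges H)"
    then obtain X where X: "X \<in> cycle_space G" "X \<noteq> {}" "X \<subseteq> edges H"
      using en unfolding indep_def by blast
    obtain D where D: "D \<subseteq> X" "D \<noteq> {}" "cycle_graph (edge_subgraph G D)"
      using cycle_space_contains_cycle[OF X(1,2)] .
    have "subgraph (edge_subgraph G D) H"
      using D X(3) H unfolding subgraph_def by auto blast
    then show False using fo D unfolding forest_def by blast
  qed
  show "forest H" if "indep (edges H)"
    unfolding forest_def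
  proof
    assume "\<exists>C. subgraph C H \<and> cycle_graph C"
    then obtain C where C: "subgraph C H" "cycle_graph C" by blast
    then have "edges C \<in> cycle_space G" "edges C \<subseteq> edges H"
      using en unfolding subgraph_def by (auto intro!: cycle_edges_in_cycle_space)
    moreover have "edges C \<noteq> {}" using C(2) unfolding cycle_graph_def by auto
    ultimately show False using that unfolding indep_def by blast
  qed
qed

lemma bases_cycle_matroid: "bases (cycle_matroid G) = {B. basis B}"
proof -
  have "(\<exists>H. B = edges H \<and> maximal_subgraph forest G H) \<longleftrightarrow> basis B" for B
  proof
    assume "\<exists>H. B = edges H \<and> maximal_subgraph forest G H"
    then obtain H where H: "B = edges H" "subgraph H G" "forest H"
      and max: "\<And>K. subgraph K G \<Longrightarrow> forest K \<Longrightarrow> subgraph H K \<Longrightarrow> K = H"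
      unfolding maximal_subgraph_def by blast
    show "basis B" unfolding basis_def
    proof (intro conjI ballI notI)
      show "indep B" using H forest_iff_indep by blast
      fix f assume f: "f \<in> edges G - B" "indep (insert f B)"
      let ?K = "\<lparr>verts = verts G, edges = insert f B, ends = ends G\<rparr>"
      have "subgraph ?K G" using f H ends_subset unfolding subgraph_def by auto
      moreover have "forest ?K" using forest_iff_indep[OF calculation] f by simp
      moreover have "subgraph H ?K" using H unfolding subgraph_def by auto blast
      ultimately have "?K = H" by (rule max)
      then have "edges H = insert f B" by (metis mgraph.select_convs(2))
      then show False using H f by auto
    qed
  next
    assume B: "basis B"
    let ?H = "\<lparr>verts = verts G, edges = B, ends = ends G\<rparr>"
    have sub: "subgraph ?H G"
      using B ends_subset unfolding subgraph_def basis_def indep_def by auto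
    have "maximal_subgraph forest G ?H" unfolding maximal_subgraph_def
    proof (intro conjI allI impI)
      show "subgraph ?H G" by fact
      show "forest ?H" using forest_iff_indep[OF sub] B unfolding basis_def by simp
      fix K assume K: "subgraph K G \<and> forest K \<and> subgraph ?H K"
      have "edges K = B"
      proof (rule ccontr)
        assume "edges K \<noteq> B"
        then obtain f where f: "f \<in> edges K" "f \<notin> B" using K unfolding subgraph_def by auto
        have "indep (edges K)" using forest_iff_indep[of K] K by simp
        moreover have "insert f B \<subseteq> edges K" using f K unfolding subgraph_def by auto
        ultimately have "indep (insert f B)" by (rule indep_subset)
        moreover have "f \<in> edges G" using f K unfolding subgraph_def by auto
        ultimately show False using B f unfolding basis_def by blast
      qed
      moreover have "verts K \<subseteq> verts G" "ends K = ends G" "verts ?H \<subseteq> verts K"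
        using K unfolding subgraph_def by blast+
      ultimately show "K = ?H" by simp
    qed
    then show "\<exists>H. B = edges H \<and> maximal_subgraph forest G H"
      by (intro exI[of _ ?H]) simp
  qed
  then show ?thesis unfolding cycle_matroid_def by auto
qed

lemma basis_nonempty:
  assumes "basis B"
  shows "B \<noteq> {}"
proof
  assume B: "B = {}"
  obtain e where e: "e \<in> edges G" using graph_G unfolding graph_def by auto
  then obtain X where X: "circuit X" "X \<subseteq> {e}" using basis_fundamental[OF assms e] B by auto
  then have "3 \<le> card X" using cycle_space_card_ge_3 unfolding circuit_def by auto
  moreover have "card X \<le> card {e}" using X(2) by (intro card_mono) auto
  ultimately show False by simp
qed

lemma basis_covers_verts:
  assumes "basis B"
  shows "\<Union>(ends G ` B) = verts G"
proof
  show "\<Union>(ends G ` B) \<subseteq> verts G"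
    using assms ends_subset unfolding basis_def indep_def by auto
  show "verts G \<subseteq> \<Union>(ends G ` B)"
  proof
    fix v assume "v \<in> verts G"
    then obtain f where f: "f \<in> edges G" "v \<in> ends G f"
      using no_isolated unfolding no_isolated_vertices_def by auto
    show "v \<in> \<Union>(ends G ` B)"
    proof (cases "f \<in> B")
      case False
      then obtain X where X: "circuit X" "f \<in> X" "X \<subseteq> insert f B"
        using basis_fundamental[OF assms f(1)] by blast
      then have "X \<in> cycle_space G" unfolding circuit_def by auto
      then obtain g where "g \<in> X" "g \<noteq> f" "v \<in> ends G g"
        using cycle_space_other_edge X(2) f(2) by metis
      then show ?thesis using X(3) by blast
    qed (use f in blast)
  qed
qed

text \<open>The edges of a circuit reachable from a given vertex again have even degrees everywhere,
  so by minimality they are all its edges.\<close>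

lemma circuit_connected:
  assumes D: "circuit D"
  shows "connected_graph (edge_subgraph G D)"
proof -
  let ?H = "edge_subgraph G D"
  have DZ: "D \<in> cycle_space G" "D \<noteq> {}" using D unfolding circuit_def by auto
  have DE: "D \<subseteq> edges G" using Z_subset[OF DZ(1)] .
  have "(u, v) \<in> (adjacency ?H)\<^sup>*" if u: "u \<in> verts ?H" and v: "v \<in> verts ?H" for u v
  proof -
    let ?X = "{e \<in> D. \<exists>x\<in>ends G e. (u, x) \<in> (adjacency ?H)\<^sup>*}"
    have reach: "(u, y) \<in> (adjacency ?H)\<^sup>*" if "e \<in> ?X" "y \<in> ends G e" for e y
      using that ends_reachable[of e ?H _ y] card_ends[of e] DE
      by (auto intro: rtrancl_trans)
    have "even (card {e \<in> ?X. y \<in> ends G e})" for y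
    proof (cases "(u, y) \<in> (adjacency ?H)\<^sup>*")
      case True
      then have "{e \<in> ?X. y \<in> ends G e} = {e \<in> D. y \<in> ends G e}" by auto
      then show ?thesis using DZ unfolding cycle_space_def by simp
    next
      case False
      then have "{e \<in> ?X. y \<in> ends G e} = {}" using reach by blast
      then show ?thesis by (metis card.empty even_zero)
    qed
    then have "?X \<in> cycle_space G" using DE unfolding cycle_space_def by auto
    moreover have "?X \<noteq> {}" using u by auto
    moreover have "?X \<subseteq> D" by auto
    ultimately have "?X = D" by (rule circuit_minimal[OF D])
    moreover obtain d where "d \<in> D" "v \<in> ends G d" using v by auto
    ultimately show ?thesis using reach[of d v] by blast
  qed
  moreover have "verts ?H \<noteq> {}" using DZ DE ends_nonempty by fastforce
  ultimately show ?thesis unfolding connected_graph_def by blast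
qed

lemma circuit_reachable:
  assumes "circuit D" and "u \<in> \<Union>(ends G ` D)" and "v \<in> \<Union>(ends G ` D)"
  shows "(u, v) \<in> (adjacency G)\<^sup>*"
proof -
  have "D \<subseteq> edges G" using assms(1) Z_subset unfolding circuit_def by auto
  then have "adjacency (edge_subgraph G D) \<subseteq> adjacency G"
    unfolding adjacency_def by auto
  then have "(adjacency (edge_subgraph G D))\<^sup>* \<subseteq> (adjacency G)\<^sup>*" by (rule rtrancl_mono)
  moreover have "(u, v) \<in> (adjacency (edge_subgraph G D))\<^sup>*"
    using circuit_connected[OF assms(1)] assms(2,3)
    unfolding connected_graph_def edge_subgraph_simps by blast
  ultimately show ?thesis by blast
qed

lemma spanning_circuit_connected:
  assumes D: "circuit D" and "verts G \<subseteq> \<Union>(ends G ` D)"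
  shows "connected_graph G"
proof -
  have "verts G \<noteq> {}" using graph_G ends_subset ends_nonempty unfolding graph_def by fastforce
  moreover have "(u, v) \<in> (adjacency G)\<^sup>*" if "u \<in> verts G" "v \<in> verts G" for u v
    using that assms(2) by (intro circuit_reachable[OF D]) (rule subsetD; assumption)+
  ultimately show ?thesis unfolding connected_graph_def by simp
qed

lemma rank_size_circuit_disconnected:
  assumes D: "circuit D" and B: "basis B" and card: "card D = card B"
    and disc: "\<not> connected_graph G"
  obtains h e where "h \<in> edges G" "e \<in> D" "basis (insert h (D - {e}))"
    "ends G h \<inter> \<Union>(ends G ` D) = {}"
    "\<And>f. f \<in> edges G \<Longrightarrow> f \<noteq> h \<Longrightarrow> ends G f \<subseteq> \<Union>(ends G ` D)"
proof -
  let ?V = "\<Union>(ends G ` D)"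
  have DZ: "D \<in> cycle_space G" "D \<noteq> {}" using D unfolding circuit_def by auto
  have DE: "D \<subseteq> edges G" using Z_subset[OF DZ(1)] .
  obtain e where e: "e \<in> D" using DZ by auto
  have iD: "indep (D - {e})" using circuit_minus_indep[OF D e] .
  have cD: "Suc (card (D - {e})) = card D" using e Z_finite[OF DZ(1)] by (metis card_Suc_Diff1)
  then obtain h where h: "h \<in> B" "h \<notin> D - {e}" "indep (insert h (D - {e}))"
    using augment[OF iD, of B] B card unfolding basis_def by auto
  have hE: "h \<in> edges G" using h(3) unfolding indep_def by auto
  have B': "basis (insert h (D - {e}))"
    using h(2,3) cD card indep_finite[OF iD] by (intro indep_card_basis[OF _ B]) auto
  have cover: "verts G \<subseteq> ?V \<union> ends G h" using basis_covers_verts[OF B'] by auto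
  have apart: False if f: "f \<in> edges G" "x \<in> ends G f" "x \<in> ?V" "y \<in> ends G f" "y \<in> ends G h"
    for f x y
  proof -
    have xG: "x \<in> verts G" using f ends_subset by auto
    have yx: "(y, x) \<in> (adjacency G)\<^sup>*" using ends_reachable f card_ends by metis
    have "(v, x) \<in> (adjacency G)\<^sup>*" if "v \<in> verts G" for v
    proof (cases "v \<in> ?V")
      case True
      then show ?thesis using circuit_reachable[OF D] f(3) by blast
    next
      case False
      then have "v \<in> ends G h" using cover that by auto
      then have "(v, y) \<in> (adjacency G)\<^sup>*" using ends_reachable[OF hE card_ends[OF hE]] f(5) by blast
      then show ?thesis using yx by (rule rtrancl_trans)
    qed
    then have "connected_graph G" using connected_graph_hub[OF xG] by blast
    with disc show False ..
  qed
  have "ends G h \<inter> ?V = {}" using apart[OF hE] by blast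
  moreover have "ends G f \<subseteq> ?V" if f: "f \<in> edges G" "f \<noteq> h" for f
  proof (rule ccontr)
    assume "\<not> ends G f \<subseteq> ?V"
    then obtain y where y: "y \<in> ends G f" "y \<notin> ?V" by blast
    have VG: "x \<in> ?V \<or> x \<in> ends G h" if "x \<in> ends G f" for x
      using cover ends_subset[OF f(1)] that by (meson UnE subsetD)
    then have "x \<notin> ?V" if "x \<in> ends G f" for x
      using apart[OF f(1) that _ y(1)] y by metis
    then have "ends G f \<subseteq> ends G h" using VG by (meson subsetI)
    moreover have "finite (ends G h)" using card_ends[OF hE] by (metis card.infinite zero_neq_numeral)
    ultimately have "ends G f = ends G h"
      using card_ends[OF hE] card_ends[OF f(1)] by (simp add: card_subset_eq)
    then show False using ends_eqD f hE by blast
  qed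
  ultimately show thesis by (intro that[OF hE e B'])
qed

lemma connected_subgraph_in_closed_set:
  assumes L: "subgraph L G" "connected_graph L" and v: "v \<in> verts L" "v \<in> S"
    and closed: "\<And>e. e \<in> edges G \<Longrightarrow> ends G e \<inter> S \<noteq> {} \<Longrightarrow> ends G e \<subseteq> S"
  shows "verts L \<subseteq> S"
proof
  fix w assume w: "w \<in> verts L"
  have "(v, w) \<in> (adjacency L)\<^sup>*" using L(2) v w unfolding connected_graph_def by auto
  then show "w \<in> S"
  proof induction
    case base
    then show ?case using v by simp
  next
    case (step y z)
    then obtain e where "e \<in> edges L" "ends L e = {y, z}" unfolding adjacency_def by auto
    then have "e \<in> edges G" "ends G e = {y, z}" using L(1) unfolding subgraph_def by auto
    then show ?case using closed[of e] step.IH by auto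
  qed
qed

lemma subgraph_edge_subgraphI:
  assumes L: "subgraph L G" and "verts L \<subseteq> \<Union>(ends G ` X)"
    and X: "\<And>e. e \<in> edges G \<Longrightarrow> e \<notin> X \<Longrightarrow> \<not> ends G e \<subseteq> \<Union>(ends G ` X)"
  shows "subgraph L (edge_subgraph G X)"
proof -
  have "e \<in> X" if e: "e \<in> edges L" for e
  proof (rule ccontr)
    assume "e \<notin> X"
    moreover have "e \<in> edges G" "ends G e \<subseteq> verts L" using L e unfolding subgraph_def by auto blast
    ultimately show False using X[of e] assms(2) by blast
  qed
  then have "edges L \<subseteq> X" by blast
  then show ?thesis using assms(1,2) unfolding subgraph_def edge_subgraph_simps
    by (elim conjE) simp
qed

lemma components_edge_plus_circuit:
  assumes D: "circuit D" and E: "edges G = insert h D"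
    and disj: "ends G h \<inter> \<Union>(ends G ` D) = {}"
  shows "\<exists>H K. components G = {H, K} \<and> H \<noteq> K \<and> card (edges H) = 1 \<and> cycle_graph K"
proof -
  let ?H = "edge_subgraph G {h}" and ?K = "edge_subgraph G D"
  have hE: "h \<in> edges G" using E by simp
  have DE: "D \<subseteq> edges G" using E by auto
  have D0: "D \<noteq> {}" using D unfolding circuit_def by auto
  have h0: "ends G h \<noteq> {}" using ends_nonempty[OF hE] .
  have hD: "h \<notin> D" using disj h0 by auto
  have d0: "\<And>e. e \<in> D \<Longrightarrow> ends G e \<noteq> {}" using ends_nonempty DE by auto
  have disjD: "\<And>e. e \<in> D \<Longrightarrow> ends G e \<inter> ends G h = {}" using disj by auto
  have sub: "subgraph ?H G" "subgraph ?K G"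
    using hE DE ends_subset unfolding subgraph_def by auto
  have conK: "connected_graph ?K" using circuit_connected[OF D] .
  have conH: "connected_graph ?H" unfolding connected_graph_def
    using h0 ends_reachable[of h ?H] card_ends[OF hE] by auto
  have VG: "v \<in> ends G h \<or> v \<in> \<Union>(ends G ` D)" if "v \<in> verts G" for v
    using no_isolated that E unfolding no_isolated_vertices_def by auto
  have sub_cases: "subgraph L ?H \<or> subgraph L ?K" if L: "subgraph L G" "connected_graph L" for L
  proof -
    obtain v where v: "v \<in> verts L" using L(2) unfolding connected_graph_def by auto
    then have "v \<in> verts G" using L(1) unfolding subgraph_def by auto
    then show ?thesis
    proof (rule VG[THEN disjE])
      assume "v \<in> ends G h"
      then have "verts L \<subseteq> \<Union>(ends G ` {h})"
        using connected_subgraph_in_closed_set[OF L v, of "ends G h"] E disjD by auto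
      then have "subgraph L ?H"
      proof (rule subgraph_edge_subgraphI[OF L(1)])
        show "\<not> ends G e \<subseteq> \<Union>(ends G ` {h})" if "e \<in> edges G" "e \<notin> {h}" for e
          using that E disjD[of e] d0[of e] by auto
      qed
      then show ?thesis ..
    next
      assume "v \<in> \<Union>(ends G ` D)"
      then have "verts L \<subseteq> \<Union>(ends G ` D)"
        using E disj by (intro connected_subgraph_in_closed_set[OF L v]) auto
      then have "subgraph L ?K"
      proof (rule subgraph_edge_subgraphI[OF L(1)])
        show "\<not> ends G e \<subseteq> \<Union>(ends G ` D)" if "e \<in> edges G" "e \<notin> D" for e
        proof -
          have "e = h" using that E by simp
          then show ?thesis using disj h0 by blast
        qed
      qed
      then show ?thesis ..
    qed
  qed
  have antisym: "L = L'" if "subgraph L L'" "subgraph L' L" for L L' :: "('v, 'e) mgraph"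
  proof (rule mgraph.equality)
    show "verts L = verts L'" "edges L = edges L'" "ends L = ends L'"
      using that unfolding subgraph_def by blast+
  qed simp
  have trans: "subgraph L L''" if "subgraph L L'" "subgraph L' L''"
    for L L' L'' :: "('v, 'e) mgraph"
    using that unfolding subgraph_def by (metis subset_trans)
  have nHK: "\<not> subgraph ?H ?K" "\<not> subgraph ?K ?H"
    using hD D0 unfolding subgraph_def by auto
  have "maximal_subgraph connected_graph G L \<longleftrightarrow> L = ?H \<or> L = ?K" for L
  proof
    assume "maximal_subgraph connected_graph G L"
    then have L: "subgraph L G" "connected_graph L"
      and max: "\<And>K. subgraph K G \<Longrightarrow> connected_graph K \<Longrightarrow> subgraph L K \<Longrightarrow> K = L"
      unfolding maximal_subgraph_def by blast+
    show "L = ?H \<or> L = ?K" using sub_cases[OF L] max sub conH conK by metis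
  next
    assume L: "L = ?H \<or> L = ?K"
    have "M = L" if M: "subgraph M G" "connected_graph M" "subgraph L M" for M
      using sub_cases[OF M(1,2)] L M(3) nHK antisym trans by metis
    then show "maximal_subgraph connected_graph G L"
      unfolding maximal_subgraph_def using L sub conH conK by blast
  qed
  then have "components G = {?H, ?K}" unfolding components_def by auto
  moreover have "?H \<noteq> ?K" using hD by (metis edge_subgraph_simps(2) insertI1)
  ultimately show ?thesis using circuit_cycle_graph[OF D]
    by (intro exI[of _ ?H] exI[of _ ?K]) simp
qed

end

section \<open>Truncations of graphic matroids\<close>

theorem claim3p13:
  fixes G :: "('v, 'e) mgraph" and F :: "('w, 'e) mgraph"
  assumes "graph G" and "no_parallel_edges G" and "no_isolated_vertices G"
    and "graph F" and "no_parallel_edges F" and "no_isolated_vertices F"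
    and "edges G = edges F"
    and "truncation (cycle_matroid G) = truncation (cycle_matroid F)"
    and "cycle_matroid G \<noteq> cycle_matroid F"
    and "\<not> connected_graph G"
  shows "\<exists>H K. components G = {H, K} \<and> H \<noteq> K \<and> card (edges H) = 1 \<and> cycle_graph K"
proof -
  let ?E = "edges G" and ?Z = "cycle_space G" and ?Z' = "cycle_space F"
  interpret G: simple_graph G using assms by unfold_locales
  interpret F: simple_graph F using assms by unfold_locales
  have FE: "edges F = ?E" using assms(7) by simp
  have bin': "binary_matroid ?E ?Z'" using F.binary_matroid_axioms unfolding FE .
  interpret T: same_truncation ?E ?Z ?Z'
  proof (intro same_truncation.intro same_truncation_axioms.intro)
    show "binary_matroid ?E ?Z" "binary_matroid ?E ?Z'"
      by (rule G.binary_matroid_axioms, rule bin')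
    show "{B - {x} | B x. G.basis B \<and> x \<in> B}
        = {B - {x} | B x. binary_matroid.basis ?E ?Z' B \<and> x \<in> B}"
      using assms(8) G.bases_cycle_matroid F.bases_cycle_matroid FE
      unfolding truncation_def by simp
    show "B \<noteq> {}" if "G.basis B" for B using G.basis_nonempty that .
    show "B \<noteq> {}" if "binary_matroid.basis ?E ?Z' B" for B
      using F.basis_nonempty that FE by simp
  qed
  interpret S: same_truncation ?E ?Z' ?Z by (rule T.same_truncation_sym)
  have "bases (cycle_matroid G) \<noteq> bases (cycle_matroid F)"
    using assms(7,9) unfolding cycle_matroid_def by auto
  then have "{B. G.basis B} \<noteq> {B. T.N.basis B}"
    using G.bases_cycle_matroid F.bases_cycle_matroid FE by simp
  then consider (A) C where "T.N.basis C" "\<not> G.basis C" | (B) C where "G.basis C" "\<not> T.N.basis C"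
    by blast
  then show ?thesis
  proof cases
    case A
    then have C: "G.circuit C" using S.basis_to_circuit by blast
    then have CZ: "C \<in> ?Z" unfolding G.circuit_def by simp
    obtain B where B: "G.basis B" using G.extend_to_basis[of "{}"] G.indep_def by auto
    have rank: "card C = card B" using S.rank_eq A(1) B by blast
    obtain h e where h: "h \<in> ?E" "e \<in> C" "G.basis (insert h (C - {e}))"
      "ends G h \<inter> \<Union>(ends G ` C) = {}"
      and inside: "\<And>f. f \<in> ?E \<Longrightarrow> f \<noteq> h \<Longrightarrow> ends G f \<subseteq> \<Union>(ends G ` C)"
      using G.rank_size_circuit_disconnected[OF C B rank assms(10)] by blast
    have iso: "ends G f \<inter> ends G h = {}" if "f \<in> ?E" "f \<noteq> h" for f
      using inside[OF that] h(4) by blast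
    have "f \<in> insert h C" if f: "f \<in> ?E" for f
    proof (rule ccontr)
      assume nf: "f \<notin> insert h C"
      then obtain X where X: "G.circuit X" "f \<in> X" "X \<subseteq> insert f (insert h (C - {e}))"
        using G.basis_fundamental[OF h(3) f] by blast
      have XZ: "X \<in> ?Z" "X \<noteq> {}" using X unfolding G.circuit_def by auto
      have "h \<notin> X" using G.isolated_edge_not_in_cycle_space[OF XZ(1) h(1) iso] .
      then have XC: "X \<subseteq> insert f C" using X by auto
      let ?Y = "sym_diff X C"
      have YZ: "?Y \<in> ?Z" using G.sym_diff_in_Z[OF XZ(1) CZ] .
      have fin: "finite C" using G.Z_finite[OF CZ] .
      have "X = insert f (C \<inter> X)" "?Y = insert f (C - X)" using XC X(2) nf by auto
      then have "card X = Suc (card (C \<inter> X))" "card ?Y = Suc (card (C - X))"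
        using fin nf by (metis IntD1 card_insert_disjoint finite_Int insertCI,
          metis DiffD1 card_insert_disjoint finite_Diff insertCI)
      moreover have "card C = card (C \<inter> X) + card (C - X)"
        using fin by (metis card_Int_Diff)
      moreover have "3 \<le> card X" "3 \<le> card ?Y"
        using G.cycle_space_card_ge_3 XZ YZ X(2) nf by blast+
      ultimately have "card X < card B" "card ?Y < card B" using rank by auto
      then have "X \<in> ?Z'" "?Y \<in> ?Z'" using T.Z_transfer XZ YZ B by blast+
      then have "sym_diff X ?Y \<in> ?Z'" by (rule T.N.sym_diff_in_Z)
      moreover have "sym_diff X ?Y = C" by auto
      moreover have "C \<noteq> {}" using h by auto
      ultimately show False using A(1) unfolding T.N.basis_def T.N.indep_def by auto
    qed
    then have "?E = insert h C" using h G.Z_subset[OF CZ] by auto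
    then show ?thesis using G.components_edge_plus_circuit[OF C _ h(4)] by blast
  next
    case B
    then have C: "T.N.circuit C" using T.basis_to_circuit by blast
    then have CZ': "C \<in> ?Z'" unfolding T.N.circuit_def by simp
    have iC: "G.indep C" using B unfolding G.basis_def by simp
    have CE: "C \<subseteq> ?E" using iC unfolding G.indep_def by simp
    have finC: "finite C" using G.indep_finite[OF iC] .
    have C0: "C \<noteq> {}" using C unfolding T.N.circuit_def by simp
    obtain B' where B': "T.N.basis B'" using T.N.extend_to_basis[of "{}"] T.N.indep_def by auto
    have rank: "card C = card B'" using T.rank_eq B(1) B' .
    have fundamental: "\<exists>X. G.circuit X \<and> f \<in> X \<and> X \<subseteq> insert f C \<and> card X = card C"
      if f: "f \<in> ?E" "f \<notin> C" for f
    proof -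
      obtain X where X: "G.circuit X" "f \<in> X" "X \<subseteq> insert f C"
        using G.basis_fundamental[OF B(1) f] .
      have XZ: "X \<in> ?Z" "X \<noteq> {}" using X unfolding G.circuit_def by auto
      have "\<not> card X < card C"
      proof
        assume small: "card X < card C"
        let ?Y = "sym_diff C X"
        have "X = insert f (C \<inter> X)" "?Y = insert f (C - X)" using X f by auto
        then have "card X = Suc (card (C \<inter> X))" "card ?Y = Suc (card (C - X))"
          using finC f by (metis IntD1 card_insert_disjoint finite_Int,
            metis DiffD1 card_insert_disjoint finite_Diff)
        moreover have "card C = card (C \<inter> X) + card (C - X)"
          using finC by (metis card_Int_Diff)
        moreover have "3 \<le> card X" using G.cycle_space_card_ge_3[OF XZ] .
        ultimately have "card ?Y < card B'" using rank by simp
        moreover have "X \<in> ?Z'" using T.Z_transfer XZ B(1) small by blast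
        then have "?Y \<in> ?Z'" by (rule T.N.sym_diff_in_Z[OF CZ'])
        ultimately have "?Y \<in> ?Z" using S.Z_transfer B' by blast
        then have "sym_diff ?Y X \<in> ?Z" using XZ(1) by (rule G.sym_diff_in_Z)
        moreover have "sym_diff ?Y X = C" by auto
        ultimately show False using iC C0 unfolding G.indep_def by auto
      qed
      moreover have "X \<noteq> insert f C"
      proof
        assume "X = insert f C"
        then have "verts G \<subseteq> \<Union>(ends G ` X)" using G.basis_covers_verts[OF B(1)] by auto
        then show False using G.spanning_circuit_connected[OF X(1)] assms(10) by blast
      qed
      then have "card X < card (insert f C)" using X(3) finC by (intro psubset_card_mono) auto
      then have "card X \<le> card C" using finC f by simp
      ultimately show ?thesis using X by auto
    qed
    have "?E \<noteq> C"
    proof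
      assume "?E = C"
      then have "B' \<subseteq> C" using B' unfolding T.N.basis_def T.N.indep_def by auto
      then have "B' = C" using rank finC by (simp add: card_subset_eq)
      then show False using B B' by blast
    qed
    then obtain f where f: "f \<in> ?E" "f \<notin> C" using CE by blast
    obtain X where X: "G.circuit X" "f \<in> X" "X \<subseteq> insert f C" "card X = card C"
      using fundamental[OF f] by blast
    obtain h e where h: "h \<in> ?E" "e \<in> X" "G.basis (insert h (X - {e}))"
      "ends G h \<inter> \<Union>(ends G ` X) = {}"
      and inside: "\<And>g. g \<in> ?E \<Longrightarrow> g \<noteq> h \<Longrightarrow> ends G g \<subseteq> \<Union>(ends G ` X)"
      by (rule G.rank_size_circuit_disconnected[OF X(1) B(1) X(4) assms(10)]) (rule that; assumption)
    have iso: "ends G g \<inter> ends G h = {}" if "g \<in> ?E" "g \<noteq> h" for g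
      using inside[OF that] h(4) by blast
    have hnot: "h \<notin> Y" if "G.circuit Y" for Y
      using G.isolated_edge_not_in_cycle_space[OF _ h(1) iso] that unfolding G.circuit_def by blast
    have hC: "h \<in> C" using fundamental[OF h(1)] hnot by blast
    have determined: "Y = insert g (C - {h})"
      if "G.circuit Y" "Y \<subseteq> insert g C" "card Y = card C" "g \<notin> C" for Y g
    proof (rule card_subset_eq)
      show "Y \<subseteq> insert g (C - {h})" using that hnot by blast
      show "card Y = card (insert g (C - {h}))"
        using that(3,4) finC card_Suc_Diff1[OF finC hC] by simp
    qed (use finC in simp)
    have Xeq: "X = insert f (C - {h})" using determined X f by blast
    have "g \<in> insert f C" if g: "g \<in> ?E" for g
    proof (rule ccontr)
      assume ng: "g \<notin> insert f C"
      then obtain Y where Y: "G.circuit Y" "g \<in> Y" "Y \<subseteq> insert g C" "card Y = card C"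
        using fundamental[OF g] by blast
      then have "Y = insert g (C - {h})" using determined ng by blast
      then have "sym_diff X Y = {f, g}" using Xeq f ng by auto
      moreover have "sym_diff X Y \<in> ?Z"
        using X Y unfolding G.circuit_def by (intro G.sym_diff_in_Z) auto
      ultimately have "3 \<le> card {f, g}" using G.cycle_space_card_ge_3 by (metis insert_not_empty)
      moreover have "card {f, g} \<le> 2" by (simp add: card_insert_if)
      ultimately show False by simp
    qed
    then have "?E = insert h X" using Xeq hC f CE by auto
    then show ?thesis using G.components_edge_plus_circuit[OF X(1) _ h(4)] by blast
  qed
qed

end
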